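(* For every $k\in\mathbb N$ and every vector $P=(p_1,\dots,p_k)$ with all $p_i\in\mathbb Q$, the set \[ \{n\in\mathbb N: R\text{ contains patch }P\text{ at time }n\} \] is a cut and project set.
   Context: $\mathbb N=\{1,2,3,\dots\}$, $\varphi=\frac{1+\sqrt5}{2}$, $\psi=\frac{1-\sqrt5}{2}=-\frac1\varphi$. Fibonacci numbers: $F_1=F_2=1$, $F_{m+2}=F_{m+1}+F_m$. For an integer $n\ge0$, $R(n)$ is the number of ways of writing $n$ as a sum of distinct Fibonacci numbers (i.e. the number of finite subsets $S\subset\{2,3,4,\dots\}$ with $\sum_{i\in S}F_i=n$; $R(0)=1$). Given $P=(p_1,\dots,p_k)$ with $p_i\in\mathbb Q$, one says that $R$ contains patch $P$ at time $n$ if $R(n+i)=p_iR(n)$ for each $i\in\{1,\dots,k\}$. Cut and project set: consider the lattice $L=\{(a+b\varphi,\,a+b\psi):a,b\in\mathbb Z\}\subset\mathbb R^2$. A set $S\subset\mathbb N$ is called a cut and project set here if there is a window $W\subset\left(-\frac1{\varphi^2},\frac1\varphi\right)$, which is a (possibly empty) finite union of intervals (of any type, degenerate one-point intervals allowed), such that \[ S=\left\{\frac{x-y}{\sqrt5}:(x,y)\in L,\ x>0,\ y\in W\right\}. \] *)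

theory Defs
  imports "HOL-Analysis.Analysis" "HOL-Number_Theory.Fib"
begin

definition phi :: real where
  "phi = (1 + sqrt 5) / 2"

definition psi :: real where
  "psi = (1 - sqrt 5) / 2"

text \<open>The number of ways of writing \<open>n\<close> as a sum of distinct Fibonacci numbers. Index sets
  start at \<open>2\<close>, so that \<open>fib 1 = fib 2 = 1\<close> is counted only once; all index sets
  occurring for a given \<open>n\<close> are bounded, so the cardinality is that of a finite set.\<close>

definition R :: "nat \<Rightarrow> nat" where
  "R n = card {S :: nat set. finite S \<and> S \<subseteq> {2..} \<and> (\<Sum>i\<in>S. fib i) = n}"

text \<open>The vector \<open>(p\<^sub>1, \<dots>, p\<^sub>k)\<close> is the list \<open>P\<close> of length \<open>k\<close>; lists are indexed from
  \<open>0\<close>, so \<open>p\<^sub>i = P ! (i - 1)\<close>.\<close>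

definition contains_patch :: "rat list \<Rightarrow> nat \<Rightarrow> bool" where
  "contains_patch P n \<longleftrightarrow>
     (\<forall>i\<in>{1..length P}. of_nat (R (n + i)) = P ! (i - 1) * of_nat (R n))"

definition L :: "(real \<times> real) set" where
  "L = {(of_int a + of_int b * phi, of_int a + of_int b * psi) | a b :: int. True}"

text \<open>Intervals of every type are admitted, including one-point and empty ones.\<close>

definition finite_union_of_intervals :: "real set \<Rightarrow> bool" where
  "finite_union_of_intervals W \<longleftrightarrow>
     (\<exists>\<I>. finite \<I> \<and> (\<forall>I\<in>\<I>. is_interval I) \<and> W = \<Union>\<I>)"

definition cut_and_project_set :: "nat set \<Rightarrow> bool" where
  "cut_and_project_set S \<longleftrightarrow>
     S \<subseteq> {1..} \<and>
     (\<exists>W. W \<subseteq> {- (1 / phi^2)<..<1 / phi} \<and> finite_union_of_intervals W \<and>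
          real ` S = {(x - y) / sqrt 5 | x y. (x, y) \<in> L \<and> x > 0 \<and> y \<in> W})"

end

theory Submission imports Defs begin

text \<open>
  If \<open>(x, y)\<close> is a lattice point with \<open>x > 0\<close> and \<open>y\<close> in the window \<open>(-1/\<phi>\<^sup>2, 1/\<phi>)\<close>, then
  \<open>n = (x - y) / \<surd>5\<close> is a positive integer, and since the window has length \<open>1\<close>, \<open>n\<close> determines
  \<open>y\<close>; below this \<open>y\<close> is called \<open>star n\<close>. A cut and project set is thus a set of the form
  \<open>{n \<ge> 1. star n \<in> W}\<close> for a finite union \<open>W\<close> of intervals. These sets are closed under
  intersection, and also under translation, because \<open>star (n + 1) - star n\<close> takes only two values,
  according to the side of a fixed threshold on which \<open>star n\<close> lies. As \<open>R\<close> is positive, a patch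
  at \<open>n\<close> amounts to prescribed values of the consecutive ratios \<open>r(n + i) = R(n + i + 1) / R(n + i)\<close>
  for \<open>0 \<le> i < k\<close>. So it suffices that \<open>r\<close> takes each rational value on such a set.

  That holds because \<open>r\<close> is a disguised Calkin-Wilf tree. Moving all indices of a Fibonacci
  representation up by one sends a sum \<open>n\<close> to a number \<open>shift n\<close> depending on \<open>n\<close> alone, and
  \<open>star (shift n) = \<psi> star n\<close>. Splitting representations according to whether they use the index
  \<open>2\<close> gives a recursion for \<open>R\<close> along \<open>shift\<close>. Restricted to the numbers \<open>n\<close> in the image of
  \<open>shift\<close>, which are those with \<open>star n\<close> below the threshold, two steps of the recursion
  become: an initial interval of \<open>star n\<close> is stretched by \<open>\<phi>\<^sup>2\<close> onto the whole range and there
  \<open>r(n) = 1 + r(l)\<close>; a final interval is stretched likewise and there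
  \<open>r(n) = r(l) / (1 + r(l))\<close>; on the interval in between \<open>r(n) = 1\<close>
  (lemmas \<open>long_left_child\<close>, \<open>long_right_child\<close>, \<open>long_middle\<close>). The subtractive Euclidean
  algorithm then shows that each positive rational is attained exactly on one interval
  (\<open>long_ratio_interval\<close>). The numbers outside the image of \<open>shift\<close> reduce to those inside by
  one further affine map, so each ratio corresponds to at most two intervals of the window.
\<close>

section \<open>The conjugate of a natural number in the window\<close>

text \<open>The window and the thresholds in it are written in terms of \<^term>\<open>phi\<close> alone: the window is
  \<open>(phi - 2, phi - 1)\<close>, and \<open>\<psi> = 1 - phi\<close>, \<open>\<psi>\<^sup>2 = 2 - phi\<close>, \<open>-\<psi>\<^sup>3 = 2 phi - 3\<close>,
  \<open>-\<psi>\<^sup>4 = 3 phi - 5\<close>.\<close>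

lemma phi_squared: "phi * phi = phi + 1"
  by (simp add: phi_def field_simps)

lemma phi_bounds: "8/5 < phi" "phi < 5/3"
proof -
  have "11/5 < sqrt 5" by (rule real_less_rsqrt) (simp add: power2_eq_square)
  moreover have "sqrt 5 < 7/3" by (rule real_less_lsqrt) (simp_all add: power2_eq_square)
  ultimately show "8/5 < phi" "phi < 5/3" by (simp_all add: phi_def)
qed

lemma psi_eq: "psi = 1 - phi"
  by (simp add: psi_def phi_def field_simps)

text \<open>Infinite descent: \<open>k = n \<phi>\<close> gives \<open>n = (k - n) \<phi>\<close>, because \<open>\<phi>\<^sup>2 = \<phi> + 1\<close>.\<close>

lemma phi_irrational: "real k = real n * phi \<Longrightarrow> n = 0"
proof (induction n arbitrary: k rule: less_induct)
  case (less n)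
  show ?case
  proof (rule ccontr)
    assume "n \<noteq> 0"
    hence n: "real n > 0" by simp
    have "real n * 1 < real n * phi" "real n * phi < real n * 2"
      using n phi_bounds by (intro mult_strict_left_mono; simp)+
    hence "n < k" "k < 2 * n" using less.prems by linarith+
    moreover have "real n = real (k - n) * phi"
      unfolding of_nat_diff[OF less_imp_le[OF \<open>n < k\<close>]]
      using less.prems phi_squared by algebra
    moreover have "k - n < n" using \<open>k < 2 * n\<close> \<open>n < k\<close> by linarith
    ultimately show False using less.IH[of "k - n" n] by simp
  qed
qed

text \<open>The closed form of the map \<open>\<Sum>i\<in>S. fib i \<mapsto> \<Sum>i\<in>S. fib (i + 1)\<close>; that it agrees with
  this map is lemma \<open>sum_fib_Suc_image\<close>.\<close>

definition shift :: "nat \<Rightarrow> nat" where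
  "shift n = nat (\<lfloor>real (n + 1) * phi\<rfloor> - 1)"

text \<open>The unique \<open>y\<close> in the window that is congruent to \<open>n \<psi>\<close> modulo \<open>1\<close>. If \<open>n\<close> is the sum of
  \<open>fib i\<close> over \<open>i \<in> S\<close>, it is the sum of the powers \<open>\<psi>\<^sup>i\<close>, because
  \<open>\<psi>\<^sup>i = fib (i + 1) - fib i * \<phi>\<close>.\<close>

definition star :: "nat \<Rightarrow> real" where
  "star n = real (shift n) - real n * phi"

lemma star_window: "phi - 2 < star n" "star n < phi - 1"
proof -
  let ?f = "\<lfloor>real (n + 1) * phi\<rfloor>"
  have "1 * 1 \<le> real (n + 1) * phi"
    using phi_bounds by (intro mult_mono) auto
  hence pos: "1 \<le> ?f" unfolding le_floor_iff by simp
  hence sh: "real (shift n) = of_int ?f - 1" by (simp add: shift_def)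
  have "of_int ?f \<noteq> real (n + 1) * phi"
    using phi_irrational[of "nat ?f" "n + 1"] pos by auto
  hence "of_int ?f < real (n + 1) * phi" "real (n + 1) * phi < of_int ?f + 1"
    by linarith+
  thus "phi - 2 < star n" "star n < phi - 1"
    by (simp_all add: star_def sh algebra_simps)
qed

text \<open>The window has length \<open>1\<close>, hence any integer translate of \<open>-n \<phi>\<close> that lies in it is
  \<^term>\<open>star n\<close>. This is how all values of \<^const>\<open>shift\<close> and \<^const>\<open>star\<close> are computed.\<close>

lemma shift_eqI:
  assumes "phi - 2 \<le> real k - real n * phi" "real k - real n * phi < phi - 1"
  shows "shift n = k" "star n = real k - real n * phi"
proof -
  show "shift n = k" using assms star_window[of n] unfolding star_def by linarith
  thus "star n = real k - real n * phi" by (simp add: star_def)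
qed

lemma shift_0 [simp]: "shift 0 = 0" and star_0 [simp]: "star 0 = 0"
  using shift_eqI[of 0 0] phi_bounds by simp_all

lemma psi_times_window:
  assumes "phi - 2 < y" "y < phi - 1"
  shows "phi - 2 < (1 - phi) * y" "(1 - phi) * y < 2 * phi - 3"
proof -
  have "(phi - 1) * y < (phi - 1) * (phi - 1)" "(phi - 1) * (phi - 2) < (phi - 1) * y"
    using assms phi_bounds by (intro mult_strict_left_mono; simp)+
  thus "phi - 2 < (1 - phi) * y" "(1 - phi) * y < 2 * phi - 3"
    using phi_squared by (simp_all add: algebra_simps)
qed

lemma shift_shift: "shift (shift m) = shift m + m"
  and star_shift: "star (shift m) = (1 - phi) * star m"
proof -
  have eq: "real (shift m + m) - real (shift m) * phi = (1 - phi) * star m"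
    unfolding star_def of_nat_add using phi_squared by algebra
  show "shift (shift m) = shift m + m" "star (shift m) = (1 - phi) * star m"
    using shift_eqI[of "shift m + m" "shift m"] psi_times_window[OF star_window, of m] phi_bounds
    unfolding eq by simp_all
qed

text \<open>The threshold is \<open>-\<psi>\<^sup>3 = 1/\<phi>\<^sup>3\<close>. Below it, adding \<open>\<psi>\<^sup>2\<close> stays inside the window, and above
  it adding \<open>\<psi>\<close> does. Correspondingly the gap between \<open>shift n\<close> and \<open>shift (n + 1)\<close> is long
  (two) or short (one).\<close>

definition long :: "nat \<Rightarrow> bool" where
  "long n \<longleftrightarrow> star n < 2 * phi - 3"

lemma long_0 [simp]: "long 0"
  using phi_bounds by (simp add: long_def)

lemma Suc_long:
  assumes "long n"
  shows "shift (Suc n) = shift n + 2" "star (Suc n) = star n + 2 - phi"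
proof -
  have eq: "real (shift n + 2) - real (Suc n) * phi = star n + 2 - phi"
    by (simp add: star_def algebra_simps)
  show "shift (Suc n) = shift n + 2" "star (Suc n) = star n + 2 - phi"
    using shift_eqI[of "shift n + 2" "Suc n"] assms star_window[of n] phi_bounds
    unfolding eq long_def by simp_all
qed

lemma Suc_not_long:
  assumes "\<not> long n"
  shows "shift (Suc n) = shift n + 1" "star (Suc n) = star n + 1 - phi"
proof -
  have eq: "real (shift n + 1) - real (Suc n) * phi = star n + 1 - phi"
    by (simp add: star_def algebra_simps)
  show "shift (Suc n) = shift n + 1" "star (Suc n) = star n + 1 - phi"
    using shift_eqI[of "shift n + 1" "Suc n"] assms star_window[of n] phi_bounds
    unfolding eq long_def by simp_all
qed

lemma strict_mono_shift: "strict_mono shift"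
proof (rule strict_mono_Suc_iff[THEN iffD2], intro allI)
  show "shift n < shift (Suc n)" for n
    by (cases "long n") (simp_all add: Suc_long Suc_not_long)
qed

lemma shift_eq_iff [simp]: "shift m = shift n \<longleftrightarrow> m = n"
  using strict_mono_shift by (simp add: strict_mono_eq)

lemma less_shift: "0 < n \<Longrightarrow> n < shift n"
proof (induction n)
  case (Suc n)
  have "shift n < shift (Suc n)" using strict_mono_shift by (simp add: strict_mono_def)
  moreover have "shift (Suc 0) = 2" using Suc_long(1)[of 0] by simp
  ultimately show ?case using Suc by (cases n) auto
qed simp

lemma le_shift: "n \<le> shift n"
  using less_shift[of n] by (cases n) auto

lemma long_shift: "long (shift m)"
  unfolding long_def star_shift by (rule psi_times_window(2)[OF star_window])

text \<open>Multiplication by \<open>\<psi>\<close> maps the window exactly onto its part below the threshold, and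
  dividing by \<open>\<psi>\<close> is multiplication by \<open>-\<phi>\<close>; hence the long numbers are the image of
  \<^const>\<open>shift\<close>.\<close>

lemma long_iff_shift: "long n \<longleftrightarrow> n \<in> range shift"
proof
  assume "long n"
  hence ub: "star n < 2 * phi - 3" by (simp add: long_def)
  let ?m = "shift n - n"
  have eq: "real n - real ?m * phi = - phi * star n"
    unfolding star_def of_nat_diff[OF le_shift] using phi_squared by algebra
  have "phi * (phi - 2) < phi * star n" "phi * star n < phi * (2 * phi - 3)"
    using star_window[of n] ub phi_bounds by (intro mult_strict_left_mono; simp)+
  hence "phi - 2 < - phi * star n" "- phi * star n < phi - 1"
    using phi_squared by (simp_all add: algebra_simps)
  hence "shift ?m = n" using shift_eqI(1)[of n ?m] unfolding eq by simp
  thus "n \<in> range shift" by (metis rangeI)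
qed (auto simp: long_shift)

lemma not_long_Suc_shift: "long l \<Longrightarrow> \<not> long (Suc (shift l))"
 unfolding long_iff_shift 
proof
  assume l: "l \<in> range shift" "Suc (shift l) \<in> range shift"
  then obtain m where m: "shift m = Suc (shift l)" by auto
  have "shift l < shift m" "shift m < shift (Suc l)"
    using m Suc_long(1)[of l] l by (simp_all add: long_iff_shift)
  thus False using strict_mono_shift strict_mono_less[of shift] by simp
qed

text \<open>A number missed by \<^const>\<open>shift\<close> sits in the middle of a gap of length two.\<close>

lemma not_long_cases:
  assumes "\<not> long n"
  obtains l where "long l" "n = Suc (shift l)"
proof -
  obtain n' where n': "n = Suc n'" using assms long_0 by (cases n) auto
  have "long n'"
    using assms Suc_not_long(2)[of n'] star_window[of n'] phi_bounds n'
    by (auto simp: long_def)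
  then obtain l where l: "n' = shift l" by (auto simp: long_iff_shift)
  have "long l"
    using l n' assms Suc_not_long(1)[of l] by (metis Suc_eq_plus1 long_shift)
  thus ?thesis using that l n' by blast
qed


section \<open>Fibonacci representations under the shift\<close>

definition index_sets :: "nat set set" where
  "index_sets = {S. finite S \<and> S \<subseteq> {2..}}"

lemma R_eq_card: "R n = card {S \<in> index_sets. sum fib S = n}"
  by (simp add: R_def index_sets_def conj_assoc)

lemma index_sets_empty: "{} \<in> index_sets"
  by (simp add: index_sets_def)

lemma index_sets_Suc_image: "T \<in> index_sets \<Longrightarrow> Suc ` T \<in> index_sets"
  and index_sets_insert_2: "T \<in> index_sets \<Longrightarrow> insert 2 (Suc ` T) \<in> index_sets"
  by (auto simp: index_sets_def)

lemma two_notin_Suc_image: "T \<in> index_sets \<Longrightarrow> 2 \<notin> Suc ` T"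
  by (auto simp: index_sets_def)

lemma sum_fib_insert_2:
  "T \<in> index_sets \<Longrightarrow> sum fib (insert 2 (Suc ` T)) = Suc (sum fib (Suc ` T))"
  using two_notin_Suc_image[of T] by (simp add: index_sets_def)

lemma index_sets_cases:
  assumes "S \<in> index_sets"
  obtains T where "T \<in> index_sets" "S = Suc ` T" | T where "T \<in> index_sets" "S = insert 2 (Suc ` T)"
proof -
  let ?T = "{i. 2 \<le> i \<and> Suc i \<in> S}"
  have "finite (Suc ` ?T)" using assms by (auto simp: index_sets_def intro: finite_subset)
  hence T: "?T \<in> index_sets" by (auto simp: index_sets_def dest: finite_imageD)
  have eq: "S - {2} = Suc ` ?T"
  proof (intro set_eqI iffI)
    fix i assume "i \<in> S - {2}"
    moreover from this have "2 \<le> i" "i \<noteq> 2" using assms by (auto simp: index_sets_def)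
    ultimately show "i \<in> Suc ` ?T" by (intro image_eqI[of _ _ "i - 1"]) auto
  qed auto
  show thesis
  proof (cases "2 \<in> S")
    case True
    hence "S = insert 2 (Suc ` ?T)" using eq by blast
    thus ?thesis using that(2) T by blast
  next
    case False
    hence "S = Suc ` ?T" using eq by blast
    thus ?thesis using that(1) T by blast
  qed
qed

lemma index_sets_induct [consumes 1, case_names empty shifted insert_2]:
  assumes "S \<in> index_sets" "P {}"
    and "\<And>T. T \<in> index_sets \<Longrightarrow> P T \<Longrightarrow> P (Suc ` T)"
    and "\<And>T. T \<in> index_sets \<Longrightarrow> P T \<Longrightarrow> P (insert 2 (Suc ` T))"
  shows "P S"
proof -
  obtain N where "\<forall>i\<in>S. i < N"
    using assms(1) by (auto simp: index_sets_def finite_nat_set_iff_bounded)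
  thus ?thesis using assms(1)
  proof (induction N arbitrary: S)
    case 0
    thus ?case using assms(2) by (metis all_not_in_conv not_less_zero)
  next
    case (Suc N)
    from Suc.prems(2) show ?case
    proof (cases rule: index_sets_cases)
      case (1 T)
      thus ?thesis using Suc assms(3)[of T] by auto
    next
      case (2 T)
      thus ?thesis using Suc assms(4)[of T] by auto
    qed
  qed
qed

text \<open>The effect of raising all indices depends only on the sum. In the inductive step, raising
  twice adds the two previous sums by the Fibonacci recurrence, matching \<open>shift_shift\<close>; an extra
  index \<open>2\<close> adds \<open>1\<close> before and \<open>fib 3 = 2\<close> after, matching the long gap at
  \<^term>\<open>shift m\<close>.\<close>

lemma sum_fib_Suc_image: "S \<in> index_sets \<Longrightarrow> sum fib (Suc ` S) = shift (sum fib S)"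
proof (induction S rule: index_sets_induct)
  case (shifted T)
  have "sum fib (Suc ` Suc ` T) = (\<Sum>i\<in>T. fib (Suc i) + fib i)"
    by (simp add: sum.reindex)
  also have "\<dots> = sum fib (Suc ` T) + sum fib T"
    by (simp add: sum.distrib sum.reindex)
  finally show ?case using shifted by (simp add: shift_shift)
next
  case (insert_2 T)
  have "sum fib (Suc ` insert 2 (Suc ` T)) = 2 + sum fib (Suc ` Suc ` T)"
    using insert_2.hyps by (subst image_insert, subst sum.insert)
      (auto simp: index_sets_def numeral_2_eq_2)
  also have "sum fib (Suc ` Suc ` T) = (\<Sum>i\<in>T. fib (Suc i) + fib i)"
    by (simp add: sum.reindex)
  also have "\<dots> = sum fib (Suc ` T) + sum fib T"
    by (simp add: sum.distrib sum.reindex)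
  finally show ?case
    using insert_2 by (simp add: shift_shift sum_fib_insert_2 Suc_long(1)[OF long_shift] del: sum.insert)
qed simp

lemma le_Suc_fib: "i \<le> Suc (fib i)"
proof (induction i rule: fib.induct)
  case (3 n)
  thus ?case using fib_neq_0_nat[of n] fib_neq_0_nat[of "Suc n"] by (cases n) auto
qed auto

lemma finite_bounded_sum_fib: "finite {S \<in> index_sets. sum fib S \<le> n}"
proof (rule finite_subset)
  show "{S \<in> index_sets. sum fib S \<le> n} \<subseteq> Pow {..Suc n}"
  proof (intro subsetI PowI)
    fix S i assume "S \<in> {S \<in> index_sets. sum fib S \<le> n}" and "i \<in> S"
    hence S: "S \<in> index_sets" "sum fib S \<le> n" "i \<in> S" by auto
    have "fib i \<le> sum fib S" using S by (intro member_le_sum) (auto simp: index_sets_def)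
    thus "i \<in> {..Suc n}" using S le_Suc_fib[of i] by simp
  qed
qed simp

text \<open>The first summand counts the representations of \<open>n\<close> that avoid the index \<open>2\<close>, the second
  those that use it; in both cases the remaining indices are lowered by one.\<close>

lemma R_recursion:
  "R n = card {T \<in> index_sets. shift (sum fib T) = n}
       + card {T \<in> index_sets. Suc (shift (sum fib T)) = n}"
proof -
  let ?A = "{T \<in> index_sets. shift (sum fib T) = n}"
  let ?B = "{T \<in> index_sets. Suc (shift (sum fib T)) = n}"
  let ?f = "\<lambda>T. Suc ` T" and ?g = "\<lambda>T. insert 2 (Suc ` T)"
  have "?A \<subseteq> {S \<in> index_sets. sum fib S \<le> n}" "?B \<subseteq> {S \<in> index_sets. sum fib S \<le> n}"
    using le_shift by (auto intro: le_SucI)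
  hence fin: "finite ?A" "finite ?B"
    using finite_bounded_sum_fib by (auto dest: finite_subset)
  have "{S \<in> index_sets. sum fib S = n} = ?f ` ?A \<union> ?g ` ?B"
  proof (intro subset_antisym subsetI)
    fix S assume "S \<in> {S \<in> index_sets. sum fib S = n}"
    hence S: "S \<in> index_sets" "sum fib S = n" by auto
    from S(1) show "S \<in> ?f ` ?A \<union> ?g ` ?B"
      by (cases rule: index_sets_cases)
        (use S(2) in \<open>auto simp: sum_fib_insert_2 sum_fib_Suc_image simp del: sum.insert\<close>)
  qed (auto simp: index_sets_Suc_image index_sets_insert_2 sum_fib_insert_2 sum_fib_Suc_image
        simp del: sum.insert)
  moreover have "?f ` ?A \<inter> ?g ` ?B = {}"
    using two_notin_Suc_image by blast
  moreover have "inj_on ?f ?A"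
    by (simp add: inj_on_def inj_image_eq_iff)
  moreover have "inj_on ?g ?B"
  proof (rule inj_onI)
    fix S T assume "S \<in> ?B" "T \<in> ?B" "?g S = ?g T"
    hence "Suc ` S = Suc ` T"
      using two_notin_Suc_image[of S] two_notin_Suc_image[of T] by (metis (no_types, lifting) insert_ident mem_Collect_eq)
    thus "S = T" by (simp add: inj_image_eq_iff)
  qed
  ultimately show ?thesis
    using fin by (simp add: R_eq_card card_Un_disjoint card_image)
qed

lemma R_Suc_shift:
  assumes "long m"
  shows "R (Suc (shift m)) = R m"
proof -
  have "shift k \<noteq> Suc (shift m)" for k
    using not_long_Suc_shift[OF assms] by (metis long_shift)
  thus ?thesis by (simp add: R_recursion[of "Suc (shift m)"]) (simp add: R_eq_card)
qed

text \<open>If the gap at \<open>m\<close> is short, then \<open>shift (m + 1) = shift m + 1\<close>, so that a representation of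
  \<open>m\<close> can also be raised and completed by the index \<open>2\<close>.\<close>

lemma R_shift_Suc:
  "R (shift (Suc m)) = (if long m then R (Suc m) else R (Suc m) + R m)"
proof (cases "long m")
  case True
  have "Suc (shift k) \<noteq> shift (Suc m)" for k
  proof
    assume "Suc (shift k) = shift (Suc m)"
    hence "shift k = Suc (shift m)" by (simp add: Suc_long(1)[OF True])
    thus False using not_long_Suc_shift[OF True] by (metis long_shift)
  qed
  thus ?thesis using True by (simp add: R_recursion[of "shift (Suc m)"]) (simp add: R_eq_card)
next
  case False
  hence "Suc (shift k) = shift (Suc m) \<longleftrightarrow> k = m" for k
    by (simp add: Suc_not_long(1))
  thus ?thesis using False by (simp add: R_recursion[of "shift (Suc m)"]) (simp add: R_eq_card)
qed

lemma R_pos: "0 < R n"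
proof (induction n rule: less_induct)
  case (less n)
  show ?case
  proof (cases "n = 0")
    case True
    have "{} \<in> {S \<in> index_sets. sum fib S = n}" using True by (simp add: index_sets_empty)
    moreover have "finite {S \<in> index_sets. sum fib S = n}"
      by (rule finite_subset[OF _ finite_bounded_sum_fib[of n]]) auto
    ultimately show ?thesis unfolding R_eq_card by (metis card_gt_0_iff empty_iff)
  next
    case False
    show ?thesis
    proof (cases "long n")
      case True
      then obtain m where m: "n = shift m" by (auto simp: long_iff_shift)
      then obtain k where k: "m = Suc k" using False by (cases m) auto
      show ?thesis using less[of m] less_shift[of m] m k by (simp add: R_shift_Suc)
    next
      case F: False
      then obtain l where "long l" "n = Suc (shift l)" by (rule not_long_cases)
      thus ?thesis using less[of l] le_shift[of l] by (simp add: R_Suc_shift)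
    qed
  qed
qed

section \<open>The Calkin-Wilf structure of consecutive ratios\<close>

text \<open>If \<^term>\<open>star n\<close> lies below \<open>-\<psi>\<^sup>4\<close>, then \<open>n = shift m\<close> with \<open>m = shift l + 1\<close> in the middle
  of a gap, and the gap at \<open>m\<close> is short. So \<open>n + 1 = shift (m + 1)\<close> inherits the
  representations of both \<open>m\<close> and \<open>m + 1 = shift (l + 1)\<close>. The affine map inverts
  \<open>y \<mapsto> \<psi>\<^sup>2 (y + \<psi>)\<close>.\<close>

lemma long_left_child:
  assumes "long n" "star n < 3 * phi - 5"
  obtains l where "long l" "star l = (phi + 1) * star n + (phi - 1)"
    "R n = R l" "R (Suc n) = R l + R (Suc l)"
proof -
  obtain m where m: "n = shift m" using assms(1) by (auto simp: long_iff_shift)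
  have "\<not> long m"
  proof
    assume "long m"
    hence "(phi - 1) * star m < (phi - 1) * (2 * phi - 3)"
      using phi_bounds by (intro mult_strict_left_mono) (auto simp: long_def)
    thus False using assms(2) phi_squared unfolding m star_shift by (simp add: algebra_simps)
  qed
  then obtain l where l: "long l" "m = Suc (shift l)" by (rule not_long_cases)
  have S: "Suc m = shift (Suc l)" "shift (Suc m) = Suc n"
    using l m \<open>\<not> long m\<close> by (simp_all add: Suc_long(1) Suc_not_long(1))
  have "star l = (phi + 1) * star n + (phi - 1)"
    unfolding m star_shift l(2) Suc_long(2)[OF long_shift] using phi_squared by algebra
  moreover have "R n = R l"
    using l by (simp add: m R_shift_Suc long_shift R_Suc_shift)
  moreover have "R (Suc m) = R (Suc l)"
    using l(1) by (simp add: S(1) R_shift_Suc)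
  hence "R (Suc n) = R l + R (Suc l)"
    unfolding S(2)[symmetric] R_shift_Suc[of m] using l \<open>\<not> long m\<close>
    by (simp add: R_Suc_shift)
  ultimately show ?thesis using that l(1) by blast
qed

text \<open>Here \<open>n\<close> is the successor of a left child: \<open>n = shift (m + 1)\<close> with \<open>m = shift l + 1\<close> as in the
  previous lemma. Now \<open>n\<close> itself inherits the representations of both \<open>m\<close> and \<open>m + 1\<close>, and the
  affine map inverts \<open>y \<mapsto> \<psi>\<^sup>2 (y + \<psi> + 1)\<close>.\<close>

lemma long_right_child:
  assumes "long n" "0 < star n"
  obtains l where "long l" "star l = (phi + 1) * star n + (phi - 2)"
    "R n = R l + R (Suc l)" "R (Suc n) = R (Suc l)"
proof -
  obtain k where k: "n = shift k" using assms(1) by (auto simp: long_iff_shift)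
  have neg: "star k < 0"
    using assms(2) phi_bounds unfolding k star_shift by (simp add: zero_less_mult_iff)
  then obtain m where m: "k = Suc m" by (cases k) auto
  have "\<not> long m"
    using neg star_window[of m] phi_bounds Suc_long(2)[of m] m by auto
  then obtain l where l: "long l" "m = Suc (shift l)" by (rule not_long_cases)
  have S: "Suc m = shift (Suc l)"
    using l by (simp add: Suc_long(1))
  have "star k = (1 - phi) * star l + 2 - phi + 1 - phi"
    unfolding m Suc_not_long(2)[OF \<open>\<not> long m\<close>]
    by (simp add: l(2) Suc_long(2)[OF long_shift] star_shift)
  hence "star l = (phi + 1) * star n + (phi - 2)"
    unfolding k star_shift using phi_squared by algebra
  moreover have RS: "R (Suc m) = R (Suc l)"
    unfolding S using l(1) by (simp add: R_shift_Suc)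
  moreover have "R n = R l + R (Suc l)"
    using l \<open>\<not> long m\<close> RS by (simp add: k m R_shift_Suc R_Suc_shift)
  moreover have "R (Suc n) = R (Suc l)"
    unfolding k m using RS by (simp add: R_Suc_shift S long_shift)
  ultimately show ?thesis using that l(1) by metis
qed

text \<open>In the remaining range \<open>n = shift m\<close> lies between two long gaps (or \<open>n = 0\<close>), so that both
  \<open>n\<close> and \<open>n + 1\<close> inherit exactly the representations of \<open>m\<close>.\<close>

lemma long_middle:
  assumes "long n" "3 * phi - 5 \<le> star n" "star n \<le> 0"
  shows "R (Suc n) = R n"
proof -
  obtain m where m: "n = shift m" using assms(1) by (auto simp: long_iff_shift)
  have "long m"
  proof (rule ccontr)
    assume "\<not> long m"
    hence "(phi - 1) * (2 * phi - 3) < (phi - 1) * star m"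
      using phi_bounds Suc_not_long(2)[of m] star_window[of "Suc m"]
      by (intro mult_strict_left_mono) (auto simp: long_def)
    thus False using assms(2) phi_squared unfolding m star_shift by (simp add: algebra_simps)
  qed
  have nonneg: "0 \<le> star m"
    using assms(3) phi_bounds unfolding m star_shift by (simp add: mult_le_0_iff)
  have "R (shift m) = R m"
  proof (cases m)
    case (Suc k)
    have "long k"
      using nonneg star_window[of k] Suc_not_long(2)[of k] Suc by auto
    thus ?thesis by (simp add: Suc R_shift_Suc)
  qed simp
  thus ?thesis by (simp add: m R_Suc_shift[OF \<open>long m\<close>])
qed


lemma is_interval_affine_vimage:
  fixes J :: "real set"
  assumes "is_interval J"
  shows "is_interval {y. c * y + d \<in> J}"
  unfolding is_interval_1
proof (intro ballI allI impI, elim conjE)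
  fix a b x assume ab: "a \<in> {y. c * y + d \<in> J}" "b \<in> {y. c * y + d \<in> J}" and x: "a \<le> x" "x \<le> b"
  have "c * a \<le> c * x \<and> c * x \<le> c * b \<or> c * b \<le> c * x \<and> c * x \<le> c * a"
    using x by (cases "0 \<le> c") (auto intro: mult_left_mono mult_left_mono_neg)
  thus "x \<in> {y. c * y + d \<in> J}"
    using ab assms unfolding is_interval_1 by (smt (verit) mem_Collect_eq)
qed

text \<open>The subtractive Euclidean algorithm on the ratio \<open>a / b\<close>. The three ranges of
  \<^term>\<open>star n\<close> give ratios above, equal to and below \<open>1\<close>, so the comparison of \<open>a\<close> with \<open>b\<close> selects
  one range, and its expanding affine map reduces the pair to \<open>(a - b, b)\<close> or \<open>(a, b - a)\<close>.\<close>

lemma long_ratio_interval: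
  fixes a b :: nat
  assumes "0 < a" "0 < b"
  shows "\<exists>J. is_interval J \<and> (\<forall>n. long n \<longrightarrow> (b * R (Suc n) = a * R n \<longleftrightarrow> star n \<in> J))"
  using assms
proof (induction "a + b" arbitrary: a b rule: less_induct)
  case less
  have left: "\<exists>l. long l \<and> star l = (phi + 1) * star n + (phi - 1) \<and>
      R n = R l \<and> R (Suc n) = R l + R (Suc l)" if "long n" "star n < 3 * phi - 5" for n
    using long_left_child[OF that] by metis
  have right: "\<exists>l. long l \<and> star l = (phi + 1) * star n + (phi - 2) \<and>
      R n = R l + R (Suc l) \<and> R (Suc n) = R (Suc l)" if "long n" "0 < star n" for n
    using long_right_child[OF that] by metis
  have pos: "0 < R n" for n by (rule R_pos)
  have neg: "3 * phi - 5 < 0" using phi_bounds by simp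
  consider (eq) "a = b" | (gt) "b < a" | (lt) "a < b" by linarith
  thus ?case
  proof cases
    case eq
    have "b * R (Suc n) = a * R n \<longleftrightarrow> star n \<in> {3 * phi - 5..0}" if "long n" for n
    proof (cases "star n \<in> {3 * phi - 5..0}")
      case True
      thus ?thesis using long_middle[OF that] eq by simp
    next
      case False
      hence "star n < 3 * phi - 5 \<or> 0 < star n" by auto
      hence "R (Suc n) \<noteq> R n"
        using left[OF that] right[OF that] pos by (metis add_cancel_right_left add_cancel_right_right less_irrefl)
      thus ?thesis using False eq less.prems by simp
    qed
    thus ?thesis using is_interval_cc by blast
  next
    case gt
    then obtain J where J: "is_interval J"
      "\<And>l. long l \<Longrightarrow> b * R (Suc l) = (a - b) * R l \<longleftrightarrow> star l \<in> J"
      using less.hyps[of "a - b" b] less.prems by auto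
    let ?J = "{..<3 * phi - 5} \<inter> {y. (phi + 1) * y + (phi - 1) \<in> J}"
    have "b * R (Suc n) = a * R n \<longleftrightarrow> star n \<in> ?J" if n: "long n" for n
    proof (cases "star n < 3 * phi - 5")
      case True
      then obtain l where l: "long l" "star l = (phi + 1) * star n + (phi - 1)"
        "R n = R l" "R (Suc n) = R l + R (Suc l)" using left[OF n] by blast
      have "b * R (Suc n) = a * R n \<longleftrightarrow> b * R (Suc l) = (a - b) * R l"
      proof -
        have "a * R l = (a - b) * R l + b * R l"
          using gt by (simp flip: add_mult_distrib)
        thus ?thesis unfolding l(3,4) by (auto simp: algebra_simps)
      qed
      thus ?thesis using J(2)[OF l(1)] l(2) True by simp
    next
      case False
      hence "R (Suc n) \<le> R n"
        using right[OF n] long_middle[OF n] by (cases "0 < star n") auto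
      hence "b * R (Suc n) < a * R n"
        using gt pos[of n] by (meson le_less_trans mult_le_mono2 mult_less_cancel2)
      thus ?thesis using False by simp
    qed
    moreover have "is_interval ?J"
      using J(1) by (intro is_interval_Int is_interval_affine_vimage is_interval_io)
    ultimately show ?thesis by blast
  next
    case lt
    then obtain J where J: "is_interval J"
      "\<And>l. long l \<Longrightarrow> (b - a) * R (Suc l) = a * R l \<longleftrightarrow> star l \<in> J"
      using less.hyps[of a "b - a"] less.prems by auto
    let ?J = "{0<..} \<inter> {y. (phi + 1) * y + (phi - 2) \<in> J}"
    have "b * R (Suc n) = a * R n \<longleftrightarrow> star n \<in> ?J" if n: "long n" for n
    proof (cases "0 < star n")
      case True
      then obtain l where l: "long l" "star l = (phi + 1) * star n + (phi - 2)"
        "R n = R l + R (Suc l)" "R (Suc n) = R (Suc l)" using right[OF n] by blast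
      have "b * R (Suc n) = a * R n \<longleftrightarrow> (b - a) * R (Suc l) = a * R l"
      proof -
        have "b * R (Suc l) = (b - a) * R (Suc l) + a * R (Suc l)"
          using lt by (simp flip: add_mult_distrib)
        thus ?thesis unfolding l(3,4) by (auto simp: algebra_simps)
      qed
      thus ?thesis using J(2)[OF l(1)] l(2) True by simp
    next
      case False
      hence "R n \<le> R (Suc n)"
        using left[OF n] long_middle[OF n] by (cases "star n < 3 * phi - 5") auto
      hence "a * R n < b * R (Suc n)"
        using lt pos[of "Suc n"] by (meson le_less_trans mult_le_mono2 mult_less_cancel2)
      thus ?thesis using False by simp
    qed
    moreover have "is_interval ?J"
      using J(1) by (intro is_interval_Int is_interval_affine_vimage is_interval_oi)
    ultimately show ?thesis by blast
  qed
qed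

section \<open>Sets of numbers cut out by finite unions of intervals\<close>

text \<open>Here \<open>0\<close> is admitted as an element and \<open>W\<close> may exceed the window. This makes the class closed
  under the operations below; both are corrected only when passing to cut and project sets.\<close>

definition window_set :: "nat set \<Rightarrow> bool" where
  "window_set A \<longleftrightarrow> (\<exists>W. finite_union_of_intervals W \<and> (\<forall>n. n \<in> A \<longleftrightarrow> star n \<in> W))"

lemma finite_union_of_intervals_interval: "is_interval J \<Longrightarrow> finite_union_of_intervals J"
  unfolding finite_union_of_intervals_def by (rule exI[of _ "{J}"]) simp

lemma finite_union_of_intervals_Un:
  assumes "finite_union_of_intervals V" "finite_union_of_intervals W"
  shows "finite_union_of_intervals (V \<union> W)"
proof -
  obtain A B where "finite A" "\<forall>I\<in>A. is_interval I" "V = \<Union>A"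
    "finite B" "\<forall>I\<in>B. is_interval I" "W = \<Union>B"
    using assms unfolding finite_union_of_intervals_def by blast
  thus ?thesis unfolding finite_union_of_intervals_def by (intro exI[of _ "A \<union> B"]) auto
qed

lemma finite_union_of_intervals_Int:
  assumes "finite_union_of_intervals V" "finite_union_of_intervals W"
  shows "finite_union_of_intervals (V \<inter> W)"
proof -
  obtain A B where AB: "finite A" "\<forall>I\<in>A. is_interval I" "V = \<Union>A"
    "finite B" "\<forall>I\<in>B. is_interval I" "W = \<Union>B"
    using assms unfolding finite_union_of_intervals_def by blast
  have "V \<inter> W = \<Union> ((\<lambda>(I, J). I \<inter> J) ` (A \<times> B))" using AB by auto
  thus ?thesis unfolding finite_union_of_intervals_def
    using AB by (intro exI[of _ "(\<lambda>(I, J). I \<inter> J) ` (A \<times> B)"]) (auto intro: is_interval_Int)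
qed

lemma finite_union_of_intervals_affine_vimage:
  assumes "finite_union_of_intervals W"
  shows "finite_union_of_intervals {y. c * y + d \<in> W}"
proof -
  obtain A where A: "finite A" "\<forall>I\<in>A. is_interval I" "W = \<Union>A"
    using assms unfolding finite_union_of_intervals_def by blast
  thus ?thesis unfolding finite_union_of_intervals_def
    by (intro exI[of _ "(\<lambda>I. {y. c * y + d \<in> I}) ` A"]) (auto intro: is_interval_affine_vimage)
qed

text \<open>The form in which the dichotomy between long and short gaps is used: membership may be tested by
  a different affine function on either side of the threshold.\<close>

lemma window_set_piecewise:
  assumes V: "finite_union_of_intervals V" and W: "finite_union_of_intervals W"
    and "\<And>n. long n \<Longrightarrow> n \<in> A \<longleftrightarrow> c * star n + d \<in> V"
    and "\<And>n. \<not> long n \<Longrightarrow> n \<in> A \<longleftrightarrow> c' * star n + d' \<in> W"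
  shows "window_set A"
proof -
  let ?U = "{..<2 * phi - 3} \<inter> {y. c * y + d \<in> V} \<union> {2 * phi - 3..} \<inter> {y. c' * y + d' \<in> W}"
  have "finite_union_of_intervals ?U"
    by (intro finite_union_of_intervals_Un finite_union_of_intervals_Int
      finite_union_of_intervals_affine_vimage V W)
      (rule finite_union_of_intervals_interval, (rule is_interval_io is_interval_ci))+
  moreover have "n \<in> A \<longleftrightarrow> star n \<in> ?U" for n
    using assms(3,4)[of n] by (cases "long n") (auto simp: long_def)
  ultimately show ?thesis unfolding window_set_def by blast
qed

lemma window_set_Int: "window_set A \<Longrightarrow> window_set B \<Longrightarrow> window_set (A \<inter> B)"
  unfolding window_set_def by (metis Int_iff finite_union_of_intervals_Int)

lemma window_set_empty: "window_set {}"
  unfolding window_set_def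
  by (rule exI[of _ "{}"]) (simp add: finite_union_of_intervals_interval)

lemma window_set_UNIV: "window_set UNIV"
  unfolding window_set_def
  by (rule exI[of _ "UNIV"]) (simp add: finite_union_of_intervals_interval)

lemma window_set_Suc_vimage:
  assumes "window_set A"
  shows "window_set {n. Suc n \<in> A}"
proof -
  obtain W where W: "finite_union_of_intervals W" "\<And>n. n \<in> A \<longleftrightarrow> star n \<in> W"
    using assms unfolding window_set_def by blast
  show ?thesis
    by (rule window_set_piecewise[OF W(1) W(1), where c = 1 and d = "2 - phi" and c' = 1 and d' = "1 - phi"])
      (simp_all add: W(2) Suc_long(2) Suc_not_long(2) algebra_simps)
qed

lemma window_set_add_vimage: "window_set A \<Longrightarrow> window_set {n. n + k \<in> A}"
proof (induction k arbitrary: A)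
  case (Suc k)
  thus ?case using Suc.IH[OF window_set_Suc_vimage[OF Suc.prems]] by simp
qed simp

text \<open>For a number \<open>n = shift l + 1\<close> in the middle of a gap, \<open>R n = R l\<close> and
  \<open>R (n + 1) = R (l + 1)\<close>, so its ratio is that of the long number \<open>l\<close>.\<close>

lemma window_set_ratio: "window_set {n. of_nat (R (Suc n)) = q * (of_nat (R n) :: rat)}"
proof (cases "0 < q")
  case False
  have "of_nat (R (Suc n)) \<noteq> q * (of_nat (R n) :: rat)" for n
  proof -
    have "q * of_nat (R n) \<le> 0" using False by (simp add: mult_le_0_iff)
    moreover have "(0 :: rat) < of_nat (R (Suc n))" using R_pos by simp
    ultimately show ?thesis by linarith
  qed
  thus ?thesis by (simp add: window_set_empty)
next
  case True
  obtain i j :: int where ij: "q = Fract i j" "0 < j" by (cases q) auto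
  have "0 < i" using True ij by (simp add: zero_less_Fract_iff)
  define a b where "a = nat i" and "b = nat j"
  have ab: "0 < a" "0 < b" "q = of_nat a / of_nat b"
    using \<open>0 < i\<close> ij by (simp_all add: a_def b_def Fract_of_int_quotient)
  have ratio: "of_nat (R (Suc n)) = q * (of_nat (R n) :: rat) \<longleftrightarrow> b * R (Suc n) = a * R n" for n
  proof -
    have "of_nat (R (Suc n)) = q * (of_nat (R n) :: rat) \<longleftrightarrow>
      of_nat (b * R (Suc n)) = (of_nat (a * R n) :: rat)"
      unfolding ab(3) of_nat_mult using ab(2) by (simp add: eq_divide_eq mult.commute)
    thus ?thesis by (simp only: of_nat_eq_iff)
  qed
  obtain J where J: "is_interval J" "\<And>n. long n \<Longrightarrow> b * R (Suc n) = a * R n \<longleftrightarrow> star n \<in> J"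
    using long_ratio_interval[OF ab(1,2)] by blast
  have short: "b * R (Suc n) = a * R n \<longleftrightarrow> - phi * star n + (phi - 1) \<in> J" if n: "\<not> long n" for n
  proof -
    from n obtain l where l: "long l" "n = Suc (shift l)" by (rule not_long_cases)
    have "star l = - phi * star n + (phi - 1)"
      unfolding l(2) Suc_long(2)[OF long_shift] star_shift using phi_squared by algebra
    moreover have "R n = R l" "R (Suc n) = R (Suc l)"
      using l R_shift_Suc[of l] by (simp_all add: R_Suc_shift Suc_long(1))
    ultimately show ?thesis using J(2)[OF l(1)] by simp
  qed
  show ?thesis
    using J(1) by (intro window_set_piecewise[where V = J and W = J and c = 1 and d = 0
          and c' = "- phi" and d' = "phi - 1"])
      (simp_all add: finite_union_of_intervals_interval ratio J(2) short)
qed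

section \<open>Patches\<close>

text \<open>Appending an entry \<open>q\<close> to a patch ending in \<open>p\<close> imposes one more condition on a single
  consecutive ratio, namely that it be \<open>q / p\<close>. Before the first entry stands an implicit \<open>p\<^sub>0 = 1\<close>. If
  \<open>p = 0\<close>, the shorter patch already occurs nowhere, as \<open>R\<close> is positive, so that the value of
  \<open>q / p\<close> is immaterial.\<close>

lemma window_set_patch: "window_set {n. contains_patch P n}"
proof (induction P rule: rev_induct)
  case Nil
  thus ?case by (simp add: contains_patch_def window_set_UNIV)
next
  case (snoc q P)
  let ?k = "length P"
  define p where "p = (if P = [] then 1 else last P)"
  have step: "contains_patch (P @ [q]) n \<longleftrightarrow>
      contains_patch P n \<and> of_nat (R (Suc (n + ?k))) = q / p * (of_nat (R (n + ?k)) :: rat)" for n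
  proof -
    have "contains_patch (P @ [q]) n \<longleftrightarrow>
      contains_patch P n \<and> of_nat (R (Suc (n + ?k))) = q * (of_nat (R n) :: rat)"
    proof -
      have "{1..length (P @ [q])} = insert (Suc ?k) {1..?k}" by auto
      thus ?thesis by (auto simp: contains_patch_def nth_append)
    qed
    moreover have "q * of_nat (R n) = q / p * (of_nat (R (n + ?k)) :: rat)" if P: "contains_patch P n"
    proof -
      have eq: "of_nat (R (n + ?k)) = p * (of_nat (R n) :: rat)"
        using P by (cases "P = []") (auto simp: p_def contains_patch_def last_conv_nth Suc_le_eq)
      moreover have "p \<noteq> 0" using eq R_pos[of "n + ?k"] by auto
      ultimately show ?thesis by simp
    qed
    ultimately show ?thesis by auto
  qed
  have "{n. contains_patch (P @ [q]) n} = {n. contains_patch P n} \<inter>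
      {n. n + ?k \<in> {m. of_nat (R (Suc m)) = q / p * (of_nat (R m) :: rat)}}"
    using step by auto
  thus ?case using snoc window_set_Int window_set_add_vimage window_set_ratio by metis
qed

section \<open>Cut and project sets\<close>

lemma L_eq: "(x, y) \<in> L \<longleftrightarrow> (\<exists>c b :: int. y = of_int c - of_int b * phi \<and> x = y + of_int b * sqrt 5)"
proof -
  have sq: "phi - psi = sqrt 5" by (simp add: phi_def psi_def field_simps)
  show ?thesis
  proof
    assume "(x, y) \<in> L"
    then obtain a b :: int where "x = of_int a + of_int b * phi" "y = of_int a + of_int b * psi"
      by (auto simp: L_def)
    thus "\<exists>c b :: int. y = of_int c - of_int b * phi \<and> x = y + of_int b * sqrt 5"
      by (intro exI[of _ "a + b"] exI[of _ b]) (simp add: sq[symmetric] psi_eq algebra_simps)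
  next
    assume "\<exists>c b :: int. y = of_int c - of_int b * phi \<and> x = y + of_int b * sqrt 5"
    then obtain c b :: int where "y = of_int c - of_int b * phi" "x = y + of_int b * sqrt 5"
      by auto
    hence "x = of_int (c - b) + of_int b * phi \<and> y = of_int (c - b) + of_int b * psi"
      by (simp add: sq[symmetric] psi_eq algebra_simps)
    thus "(x, y) \<in> L" unfolding L_def by blast
  qed
qed

text \<open>A lattice point over the window has \<open>x = y + b \<surd>5\<close> for an integer \<open>b\<close>. As \<open>\<bar>y\<bar> < 1\<close>, the
  condition \<open>x > 0\<close> forces \<open>b \<ge> 0\<close>; and \<open>b = 0\<close> would make \<open>x = y\<close> an integer in the window,
  that is \<open>0\<close>.\<close>

lemma lattice_point_in_window:
  assumes "phi - 2 < y" "y < phi - 1"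
  shows "(x, y) \<in> L \<and> 0 < x \<longleftrightarrow> (\<exists>n\<ge>1. y = star n \<and> x = star n + real n * sqrt 5)"
proof
  assume "(x, y) \<in> L \<and> 0 < x"
  then obtain c b :: int where cb: "y = of_int c - of_int b * phi" "x = y + of_int b * sqrt 5" "0 < x"
    by (auto simp: L_eq)
  have b: "0 < b"
  proof (rule ccontr)
    assume "\<not> 0 < b"
    then consider "b = 0" | "b \<le> -1" by linarith
    thus False
    proof cases
      case 1
      hence "real_of_int c < 1" "0 < real_of_int c"
        using cb assms phi_bounds by simp_all
      hence "c < 1" "0 < c" by simp_all
      thus False by simp
    next
      case 2
      have "sqrt 5 = 2 * phi - 1" by (simp add: phi_def field_simps)
      moreover have "of_int b * sqrt 5 \<le> -1 * sqrt 5" using 2 by (intro mult_right_mono) auto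
      ultimately show False using cb assms phi_bounds by linarith
    qed
  qed
  have "0 \<le> of_int b * phi" using b phi_bounds by simp
  hence "-1 < real_of_int c" using cb assms phi_bounds by linarith
  hence c: "0 \<le> c" by linarith
  have "y = real (nat c) - real (nat b) * phi" using cb b c by simp
  hence "y = star (nat b)" using shift_eqI(2)[of "nat c" "nat b"] assms by simp
  thus "\<exists>n\<ge>1. y = star n \<and> x = star n + real n * sqrt 5"
    using b cb by (intro exI[of _ "nat b"]) auto
next
  assume "\<exists>n\<ge>1. y = star n \<and> x = star n + real n * sqrt 5"
  then obtain n where n: "n \<ge> 1" "y = star n" "x = star n + real n * sqrt 5" by blast
  have "sqrt 5 = 2 * phi - 1" by (simp add: phi_def field_simps)
  moreover have "1 * sqrt 5 \<le> real n * sqrt 5" using n by (intro mult_right_mono) auto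
  ultimately have "0 < x" using n assms phi_bounds by linarith
  moreover have "(x, y) \<in> L"
    unfolding L_eq using n by (intro exI[of _ "int (shift n)"] exI[of _ "int n"]) (simp add: star_def)
  ultimately show "(x, y) \<in> L \<and> 0 < x" by blast
qed

lemma window_set_imp_cut_and_project_set:
  assumes "window_set A"
  shows "cut_and_project_set {n. n \<ge> 1 \<and> n \<in> A}"
proof -
  obtain W where W: "finite_union_of_intervals W" "\<And>n. n \<in> A \<longleftrightarrow> star n \<in> W"
    using assms unfolding window_set_def by blast
  let ?I = "{phi - 2<..<phi - 1}"
  have ends: "- (1 / phi ^ 2) = phi - 2" "1 / phi = phi - 1"
  proof -
    have nz: "phi \<noteq> 0" using phi_bounds by auto
    have 1: "(phi - 1) * phi = 1" "(2 - phi) * phi ^ 2 = 1"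
      using phi_squared unfolding power2_eq_square by algebra+
    show "1 / phi = phi - 1" using 1(1) nz by (simp add: field_simps)
    have "1 / phi ^ 2 = 2 - phi" using 1(2) nz by (simp add: divide_eq_eq)
    thus "- (1 / phi ^ 2) = phi - 2" by simp
  qed
  have "real ` {n. n \<ge> 1 \<and> n \<in> A} = {(x - y) / sqrt 5 | x y. (x, y) \<in> L \<and> x > 0 \<and> y \<in> W \<inter> ?I}"
  proof (intro subset_antisym subsetI)
    fix r assume "r \<in> real ` {n. n \<ge> 1 \<and> n \<in> A}"
    then obtain n where n: "r = real n" "n \<ge> 1" "star n \<in> W" using W(2) by auto
    have "(star n + real n * sqrt 5, star n) \<in> L \<and> 0 < star n + real n * sqrt 5"
      using lattice_point_in_window[OF star_window] n by blast
    moreover have "r = (star n + real n * sqrt 5 - star n) / sqrt 5" using n by simp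
    ultimately show "r \<in> {(x - y) / sqrt 5 | x y. (x, y) \<in> L \<and> x > 0 \<and> y \<in> W \<inter> ?I}"
      using n star_window by (smt (verit) IntI greaterThanLessThan_iff mem_Collect_eq)
  next
    fix r assume "r \<in> {(x - y) / sqrt 5 | x y. (x, y) \<in> L \<and> x > 0 \<and> y \<in> W \<inter> ?I}"
    then obtain x y where xy: "r = (x - y) / sqrt 5" "(x, y) \<in> L" "0 < x" "y \<in> W" "phi - 2 < y" "y < phi - 1"
      by auto
    then obtain n where "n \<ge> 1" "y = star n" "x = star n + real n * sqrt 5"
      using lattice_point_in_window by blast
    thus "r \<in> real ` {n. n \<ge> 1 \<and> n \<in> A}" using xy W(2) by auto
  qed
  moreover have "finite_union_of_intervals (W \<inter> ?I)"
    by (intro finite_union_of_intervals_Int W(1) finite_union_of_intervals_interval is_interval_oo)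
  ultimately show ?thesis
    unfolding cut_and_project_set_def ends by (intro conjI exI[of _ "W \<inter> ?I"]) auto
qed

theorem theorem1p2:
  fixes k :: nat and P :: "rat list"
  assumes "k \<ge> 1" and "length P = k"
  shows "cut_and_project_set {n. n \<ge> 1 \<and> contains_patch P n}"
  using window_set_imp_cut_and_project_set[OF window_set_patch[of P]] by simp

end
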